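(* Let $M_{a,b}$ be an arithmetical congruence monoid. For each fixed $x \in M_{a,b}$ with $x > 1$, we have, as functions of $n \ge 1$, \[ \ell_1^M(x^n) \in \Theta(n), \qquad \ell_\infty^M(x^n) \in \Theta(n), \qquad \text{and} \qquad \ell_0^m(x^n) \in \Theta(1). \]
   Context: For integers $a, b \ge 1$ satisfying $a^2 \equiv a \bmod b$, the arithmetical congruence monoid (ACM) is the multiplicative submonoid $M_{a,b} = \{1\} \cup \{n \in \mathbb{Z}_{\ge 1} : n \equiv a \bmod b\}$ of $\mathbb{Z}_{\ge 1}$. An atom of $M_{a,b}$ is an irreducible element: an element $u \ne 1$ of $M_{a,b}$ that is not a product of two elements of $M_{a,b} \setminus \{1\}$. For $x \in M_{a,b}$, the set of factorization tuples of $x$ is $\mathsf{Z}(x) = \{\mathbf{z} \in \mathbb{Z}_{\ge 0}^k : x = u_1^{z_1} \cdots u_k^{z_k} \text{ for some } k \ge 0 \text{ and distinct atoms } u_1, \ldots, u_k \in M_{a,b}\}$. For a tuple $\mathbf{z} = (z_1, \ldots, z_k)$, let $\ell_0(\mathbf{z})$ be the number of nonzero entries of $\mathbf{z}$ (i.e. $z_1^0 + \cdots + z_k^0$ with the convention $0^0 = 0$), $\ell_1(\mathbf{z}) = z_1 + \cdots + z_k$, and $\ell_\infty(\mathbf{z}) = \max(z_1, \ldots, z_k)$. For $p \in \{0, 1, \infty\}$, let $\ell_p^M(x) = \max\{\ell_p(\mathbf{z}) : \mathbf{z} \in \mathsf{Z}(x)\}$ and $\ell_p^m(x) = \min\{\ell_p(\mathbf{z})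 : \mathbf{z} \in \mathsf{Z}(x)\}$ (the superscripts $M$, $m$ stand for maximum and minimum and are not exponents). *)

theory Defs
  imports Complex_Main "HOL-Number_Theory.Cong" "HOL-Library.Landau_Symbols"
begin

definition acm :: "nat \<Rightarrow> nat \<Rightarrow> nat set" where
  "acm a b = {1} \<union> {n. n \<ge> 1 \<and> [n = a] (mod b)}"

definition acm_atoms :: "nat \<Rightarrow> nat \<Rightarrow> nat set" where
  "acm_atoms a b =
     {u \<in> acm a b. u \<noteq> 1 \<and> \<not> (\<exists>v \<in> acm a b - {1}. \<exists>w \<in> acm a b - {1}. u = v * w)}"

text \<open>A tuple of arbitrary length \<open>k\<close> is a list. Entries may be zero, so the set of
  tuples of one element can be infinite; the values of \<open>ell0\<close>, \<open>ell1\<close> and \<open>ell_inf\<close>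
  on it are nevertheless bounded.\<close>

definition fact_tuples :: "nat \<Rightarrow> nat \<Rightarrow> nat \<Rightarrow> nat list set" where
  "fact_tuples a b x =
     {zs. \<exists>us. length us = length zs \<and> distinct us \<and> set us \<subseteq> acm_atoms a b \<and>
          x = (\<Prod>i<length zs. us ! i ^ zs ! i)}"

text \<open>In HOL \<open>0 ^ 0 = 1\<close>, so the nonzero entries are counted directly instead of
  summing zeroth powers.\<close>

definition ell0 :: "nat list \<Rightarrow> nat" where
  "ell0 zs = card {i. i < length zs \<and> zs ! i \<noteq> 0}"

definition ell1 :: "nat list \<Rightarrow> nat" where
  "ell1 zs = sum_list zs"

text \<open>Inserting \<open>0\<close> only matters for the empty tuple, whose maximum is taken to be \<open>0\<close>.\<close>

definition ell_inf :: "nat list \<Rightarrow> nat" where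
  "ell_inf zs = Max (insert 0 (set zs))"

definition max_len :: "(nat list \<Rightarrow> nat) \<Rightarrow> nat \<Rightarrow> nat \<Rightarrow> nat \<Rightarrow> nat" where
  "max_len l a b x = Max (l ` fact_tuples a b x)"

definition min_len :: "(nat list \<Rightarrow> nat) \<Rightarrow> nat \<Rightarrow> nat \<Rightarrow> nat \<Rightarrow> nat" where
  "min_len l a b x = Min (l ` fact_tuples a b x)"

end

theory Submission
  imports Defs "HOL-Library.Multiset"
begin

text \<open>A factorization of \<open>x\<close> with exponents \<open>z\<close> yields one of \<open>x ^ n\<close> with exponents \<open>n z\<close> over
  the same atoms, which gives the lower bounds for \<open>\<ell>\<^sub>1\<close> and \<open>\<ell>\<^sub>\<infinity>\<close> and the upper bound for \<open>\<ell>\<^sub>0\<close>.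
  Since every atom is at least 2, a tuple of \<open>x ^ n\<close> has
  \<open>\<ell>\<^sub>\<infinity> \<le> \<ell>\<^sub>1 \<le> n log\<^sub>2 x\<close>, and \<open>\<ell>\<^sub>0 \<ge> 1\<close> because \<open>x ^ n \<noteq> 1\<close>.\<close>

lemma acm_atoms_ge_2:
  assumes "u \<in> acm_atoms a b"
  shows "u \<ge> 2"
  using assms by (auto simp: acm_atoms_def acm_def)

text \<open>Strong induction: a non-atom other than 1 splits into two factors greater than 1, hence
  both smaller than \<open>x\<close>. With multisets the two factorizations simply add, without
  merging exponents of common atoms.\<close>

lemma acm_atomic:
  assumes "x \<in> acm a b"
  shows "\<exists>A. set_mset A \<subseteq> acm_atoms a b \<and> prod_mset A = x"
  using assms
proof (induction x rule: less_induct)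
  case (less x)
  consider "x = 1" | "x \<in> acm_atoms a b"
    | v w where "v \<in> acm a b - {1}" "w \<in> acm a b - {1}" "x = v * w"
    using less.prems by (auto simp: acm_atoms_def)
  then show ?case
  proof cases
    case 1
    then show ?thesis by (intro exI[of _ "{#}"]) simp
  next
    case 2
    then show ?thesis by (intro exI[of _ "{#x#}"]) simp
  next
    case (3 v w)
    then have "v > 1" "w > 1" by (auto simp: acm_def)
    with 3 have "v < x" "w < x" by auto
    with less.IH 3 obtain A B
      where "set_mset A \<subseteq> acm_atoms a b" "prod_mset A = v"
        and "set_mset B \<subseteq> acm_atoms a b" "prod_mset B = w"
      by (metis DiffD1)
    with 3 show ?thesis by (intro exI[of _ "A + B"]) auto
  qed
qed

text \<open>Listing the distinct atoms of a multiset factorization, with multiplicities as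
  exponents, turns it into a tuple.\<close>

lemma fact_tuples_nonempty:
  assumes "x \<in> acm a b"
  shows "fact_tuples a b x \<noteq> {}"
proof -
  obtain A where A: "set_mset A \<subseteq> acm_atoms a b" "prod_mset A = x"
    using acm_atomic[OF assms] by blast
  obtain us where us: "set us = set_mset A" "distinct us"
    using finite_distinct_list[OF finite_set_mset, of A] by blast
  have "x = (\<Prod>u\<in>set us. u ^ count A u)"
    using A us by (simp add: prod_mset_multiplicity)
  also have "\<dots> = (\<Prod>i<length us. us ! i ^ count A (us ! i))"
    by (rule prod.reindex_bij_betw[symmetric]) (rule bij_betw_nth[OF us(2)], auto)
  finally have "map (count A) us \<in> fact_tuples a b x"
    unfolding fact_tuples_def using A(1) us by (intro CollectI exI[of _ us]) simp
  then show ?thesis by blast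
qed

lemma fact_tuples_power:
  assumes "zs \<in> fact_tuples a b x"
  shows "map ((*) n) zs \<in> fact_tuples a b (x ^ n)"
proof -
  obtain us where us: "length us = length zs" "distinct us" "set us \<subseteq> acm_atoms a b"
    "x = (\<Prod>i<length zs. us ! i ^ zs ! i)"
    using assms by (auto simp: fact_tuples_def)
  have "x ^ n = (\<Prod>i<length zs. us ! i ^ (n * zs ! i))"
    by (simp add: us(4) prod_power_distrib power_mult[symmetric] mult.commute)
  with us(1-3) show ?thesis
    by (auto simp: fact_tuples_def intro!: exI[of _ us])
qed

lemma ell1_eq_sum: "ell1 zs = (\<Sum>i<length zs. zs ! i)"
  by (simp add: ell1_def sum_list_sum_nth atLeast0LessThan)

text \<open>Replacing every atom in the product by 2 can only decrease it.\<close>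

lemma two_power_ell1_le:
  assumes "zs \<in> fact_tuples a b x"
  shows "2 ^ ell1 zs \<le> x"
proof -
  obtain us where us: "length us = length zs" "set us \<subseteq> acm_atoms a b"
    "x = (\<Prod>i<length zs. us ! i ^ zs ! i)"
    using assms by (auto simp: fact_tuples_def)
  have "2 \<le> us ! i" if "i < length zs" for i
    using us that acm_atoms_ge_2 by (metis nth_mem subsetD)
  then show ?thesis
    unfolding ell1_eq_sum us(3) power_sum by (auto intro!: prod_mono power_mono)
qed

lemma ell1_power_le:
  assumes "zs \<in> fact_tuples a b (x ^ n)"
  shows "ell1 zs \<le> n * x"
proof -
  have "2 ^ ell1 zs \<le> x ^ n" by (rule two_power_ell1_le[OF assms])
  \<comment> \<open>The bound \<open>x < 2 ^ x\<close> stands in for the logarithm: cruder, but it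
    stays in the naturals and is still linear in \<open>n\<close> for fixed
    \<open>x\<close>.\<close>
  also have "\<dots> \<le> (2 ^ x) ^ n"
    by (intro power_mono) (auto intro: less_imp_le less_exp)
  finally have "(2::nat) ^ ell1 zs \<le> 2 ^ (n * x)"
    by (simp add: power_mult[symmetric] mult.commute)
  then show ?thesis by simp
qed

lemma ell_inf_le_ell1: "ell_inf zs \<le> ell1 zs"
  by (auto simp: ell_inf_def ell1_def member_le_sum_list)

lemma fact_tuples_pos_entry:
  assumes "zs \<in> fact_tuples a b x" and "x \<noteq> 1"
  shows "\<exists>i<length zs. zs ! i > 0"
proof (rule ccontr)
  assume "\<not> ?thesis"
  then have "(\<Prod>i<length zs. us ! i ^ zs ! i) = 1" for us :: "nat list"
    by (intro prod.neutral) auto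
  with assms show False by (auto simp: fact_tuples_def)
qed

lemma ell0_pos:
  assumes "zs \<in> fact_tuples a b x" and "x \<noteq> 1"
  shows "ell0 zs \<ge> 1"
  using fact_tuples_pos_entry[OF assms] by (auto simp: ell0_def Suc_le_eq card_gt_0_iff)

lemma ell_inf_pos:
  assumes "zs \<in> fact_tuples a b x" and "x \<noteq> 1"
  shows "ell_inf zs \<ge> 1"
proof -
  obtain i where "i < length zs" "zs ! i > 0"
    using fact_tuples_pos_entry[OF assms] by blast
  then have "zs ! i \<le> ell_inf zs" by (simp add: ell_inf_def)
  with \<open>zs ! i > 0\<close> show ?thesis by simp
qed

lemma ell_inf_map_mult: "ell_inf (map ((*) n) zs) = n * ell_inf zs"
proof -
  have "mono ((*) n)" by (auto simp: mono_def)
  \<comment> \<open>The inserted 0 is fixed by multiplication by \<open>n\<close>, so the image of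
    the set again has the form used in \<open>ell_inf\<close>.\<close>
  from mono_Max_commute[OF this, of "insert 0 (set zs)"]
  show ?thesis by (simp add: ell_inf_def)
qed

lemma ell0_le_length: "ell0 zs \<le> length zs"
  using card_mono[of "{..<length zs}" "{i. i < length zs \<and> zs ! i \<noteq> 0}"]
  by (auto simp: ell0_def)

text \<open>Zero entries can make the set of tuples infinite; the uniform bound \<open>N\<close>
  makes the set of values of \<open>l\<close> finite, so that \<open>Max\<close> is
  meaningful.\<close>

lemma max_len_ge:
  assumes "\<And>ws. ws \<in> fact_tuples a b x \<Longrightarrow> l ws \<le> N" and "zs \<in> fact_tuples a b x"
  shows "l zs \<le> max_len l a b x"
  unfolding max_len_def using assms by (auto intro!: Max_ge finite_subset[of _ "{..N}"])

lemma max_len_le: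
  assumes "\<And>ws. ws \<in> fact_tuples a b x \<Longrightarrow> l ws \<le> N" and "fact_tuples a b x \<noteq> {}"
  shows "max_len l a b x \<le> N"
proof -
  have "finite (l ` fact_tuples a b x)"
    using assms(1) by (auto intro!: finite_subset[of _ "{..N}"])
  with assms show ?thesis by (auto simp: max_len_def)
qed

text \<open>Each nonzero entry contributes at least 1 to the sum. This bounds the values of
  \<open>ell0\<close>, as \<open>Min\<close> also requires a finite set.\<close>

lemma ell0_le_ell1: "ell0 zs \<le> ell1 zs"
proof -
  have "ell0 zs = (\<Sum>i | i < length zs \<and> zs ! i \<noteq> 0. 1)"
    by (simp add: ell0_def)
  also have "\<dots> \<le> (\<Sum>i | i < length zs \<and> zs ! i \<noteq> 0. zs ! i)"
    by (rule sum_mono) auto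
  also have "\<dots> \<le> (\<Sum>i<length zs. zs ! i)"
    by (rule sum_mono2) auto
  finally show ?thesis by (simp add: ell1_eq_sum)
qed

lemma
  assumes "fact_tuples a b x \<noteq> {}"
  shows min_len_ell0_attained: "\<exists>zs \<in> fact_tuples a b x. min_len ell0 a b x = ell0 zs"
    and min_len_ell0_le: "zs \<in> fact_tuples a b x \<Longrightarrow> min_len ell0 a b x \<le> ell0 zs"
proof -
  \<comment> \<open>The bound on \<open>ell1\<close> is taken at exponent 1.\<close>
  have "ell0 ws \<le> x" if "ws \<in> fact_tuples a b x" for ws
    using ell0_le_ell1[of ws] ell1_power_le[of ws a b x 1] that by simp
  then have fin: "finite (ell0 ` fact_tuples a b x)"
    by (auto intro!: finite_subset[of _ "{..x}"])
  show "\<exists>zs \<in> fact_tuples a b x. min_len ell0 a b x = ell0 zs"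
    using Min_in[OF fin] assms by (auto simp: min_len_def)
  show "min_len ell0 a b x \<le> ell0 zs" if "zs \<in> fact_tuples a b x"
    using fin that by (auto simp: min_len_def)
qed

lemma bigtheta_nat_bounds:
  fixes f g :: "nat \<Rightarrow> nat"
  assumes "\<And>n. n \<ge> 1 \<Longrightarrow> g n \<le> f n" and "\<And>n. n \<ge> 1 \<Longrightarrow> f n \<le> C * g n"
  shows "(\<lambda>n. real (f n)) \<in> \<Theta>(\<lambda>n. real (g n))"
proof (rule bigthetaI)
  show "(\<lambda>n. real (f n)) \<in> O(\<lambda>n. real (g n))"
    using assms(2) by (intro bigoI[of _ "real C"] eventually_sequentiallyI[of 1])
      (simp flip: of_nat_mult)
  show "(\<lambda>n. real (f n)) \<in> \<Omega>(\<lambda>n. real (g n))"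
    unfolding bigomega_iff_bigo
    using assms(1) by (intro bigoI[of _ 1] eventually_sequentiallyI[of 1]) simp
qed

theorem theorem3p1:
  fixes a b x :: nat
  assumes "a \<ge> 1" and "b \<ge> 1" and "[a ^ 2 = a] (mod b)"
    and "x \<in> acm a b" and "x > 1"
  shows "(\<lambda>n::nat. real (max_len ell1 a b (x ^ n))) \<in> \<Theta>(\<lambda>n. real n)
       \<and> (\<lambda>n::nat. real (max_len ell_inf a b (x ^ n))) \<in> \<Theta>(\<lambda>n. real n)
       \<and> (\<lambda>n::nat. real (min_len ell0 a b (x ^ n))) \<in> \<Theta>(\<lambda>_. 1)"
proof -
  \<comment> \<open>One tuple of \<open>x\<close> is fixed for all \<open>n\<close>; its multiples
    serve as witnesses for every power.\<close>
  obtain zs where zs: "zs \<in> fact_tuples a b x"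
    using fact_tuples_nonempty[OF assms(4)] by blast
  have power: "map ((*) n) zs \<in> fact_tuples a b (x ^ n)" for n
    by (rule fact_tuples_power[OF zs])
  then have ne: "fact_tuples a b (x ^ n) \<noteq> {}" for n by blast
  have l1_le: "ell1 ws \<le> n * x" if "ws \<in> fact_tuples a b (x ^ n)" for ws n
    by (rule ell1_power_le[OF that])
  have inf_le: "ell_inf ws \<le> n * x" if "ws \<in> fact_tuples a b (x ^ n)" for ws n
    using ell_inf_le_ell1 l1_le[OF that] by (rule order_trans)
  have inf_ge: "n \<le> ell_inf (map ((*) n) zs)" for n
    using ell_inf_pos[OF zs] assms(5) by (simp add: ell_inf_map_mult)
  have "n \<le> max_len ell_inf a b (x ^ n)" for n
    using inf_ge max_len_ge[OF inf_le power] by (rule order_trans)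
  \<comment> \<open>The lower bound for \<open>ell1\<close> is inherited from
    \<open>ell_inf\<close>.\<close>
  moreover have "n \<le> max_len ell1 a b (x ^ n)" for n
    using order_trans[OF inf_ge ell_inf_le_ell1] max_len_ge[OF l1_le power]
    by (rule order_trans)
  moreover have "max_len ell_inf a b (x ^ n) \<le> x * n" for n
    using max_len_le[OF inf_le ne] by (simp add: mult.commute)
  moreover have "max_len ell1 a b (x ^ n) \<le> x * n" for n
    using max_len_le[OF l1_le ne] by (simp add: mult.commute)
  \<comment> \<open>Scaling keeps the length of the tuple, so this bound is independent of
    \<open>n\<close>.\<close>
  moreover have "min_len ell0 a b (x ^ n) \<le> length zs * 1" for n
    using order_trans[OF min_len_ell0_le[OF ne power] ell0_le_length] by simp
  \<comment> \<open>The case \<open>n = 0\<close> is excluded because 1 has the empty factorization,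
    with \<open>ell0\<close> equal to 0.\<close>
  moreover have "1 \<le> min_len ell0 a b (x ^ n)" if "n \<ge> 1" for n
  proof -
    have "x ^ n \<noteq> 1" using assms(5) that by auto
    with min_len_ell0_attained[OF ne] ell0_pos show ?thesis by metis
  qed
  ultimately show ?thesis
    using bigtheta_nat_bounds[of "\<lambda>_. 1" "\<lambda>n. min_len ell0 a b (x ^ n)" "length zs"]
    by (auto intro!: bigtheta_nat_bounds[where g = "\<lambda>n. n"])
qed

end
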